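(* Let $\Sigma=(\mathsf{P}_\Sigma,\mathsf{R}_\Sigma,\rho^\Sigma)$ be a PR-structure. Then $\Sigma$ is posetal if and only if it is preorderal and the relation $\vdash^\Sigma$ on $\mathsf{P}_\Sigma$ is antisymmetric.
   Context: A PR-structure is a triple $\Sigma=(\mathsf{P}_\Sigma,\mathsf{R}_\Sigma,\rho^\Sigma)$ where $\mathsf{P}_\Sigma$ and $\mathsf{R}_\Sigma$ are non-empty sets and $\rho^\Sigma:\mathsf{P}_\Sigma\times\mathsf{P}_\Sigma\to\mathcal{P}(\mathsf{R}_\Sigma)$ is a function. For a set $I$ and functions $\varphi,\psi:I\to\mathsf{P}_\Sigma$, write $\varphi\vdash^\Sigma_I\psi$ iff $\bigcap_{i\in I}\rho^\Sigma(\varphi(i),\psi(i))\neq\emptyset$, i.e. iff there is $r\in\mathsf{R}_\Sigma$ with $r\in\rho^\Sigma(\varphi(i),\psi(i))$ for every $i\in I$. For $a,b\in\mathsf{P}_\Sigma$, write $a\vdash^\Sigma b$ iff $\rho^\Sigma(a,b)\neq\emptyset$. $\Sigma$ is preorderal (resp. posetal) if for every set $I$ the relation $\vdash^\Sigma_I$ on $\mathsf{P}_\Sigma^I$ is a preorder (resp. a partial order). *)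

theory Defs
  imports "HOL-Library.FuncSet"
begin

text \<open>
  The component \<open>rho\<close> is a total HOL function; only its values on \<open>Pset \<times> Pset\<close> matter.
\<close>

record ('p, 'r) pr_data =
  Pset :: "'p set"
  Rset :: "'r set"
  rho :: "'p \<Rightarrow> 'p \<Rightarrow> 'r set"

locale pr_structure =
  fixes \<Sigma> :: "('p, 'r) pr_data"
  assumes Pset_nonempty: "Pset \<Sigma> \<noteq> {}"
    and Rset_nonempty: "Rset \<Sigma> \<noteq> {}"
    and rho_closed: "\<lbrakk>a \<in> Pset \<Sigma>; b \<in> Pset \<Sigma>\<rbrakk> \<Longrightarrow> rho \<Sigma> a b \<subseteq> Rset \<Sigma>"

text \<open>
  For \<open>I = {}\<close> the intersection of the sets \<open>\<rho>(\<phi> i, \<psi> i)\<close> is the whole set \<open>Rset \<Sigma>\<close>,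
  which is why \<open>r\<close> ranges over \<open>Rset \<Sigma>\<close>.
\<close>

definition entails :: "('p, 'r) pr_data \<Rightarrow> 'i set \<Rightarrow> ('i \<Rightarrow> 'p) \<Rightarrow> ('i \<Rightarrow> 'p) \<Rightarrow> bool" where
  "entails \<Sigma> I \<phi> \<psi> \<longleftrightarrow> (\<exists>r\<in>Rset \<Sigma>. \<forall>i\<in>I. r \<in> rho \<Sigma> (\<phi> i) (\<psi> i))"

text \<open>
  Functions from \<open>I\<close> to \<open>Pset \<Sigma>\<close> are extensional HOL functions, so that equality
  in \<open>I \<rightarrow>\<^sub>E Pset \<Sigma>\<close> is equality of functions on \<open>I\<close>.
\<close>

definition entails_rel :: "('p, 'r) pr_data \<Rightarrow> 'i set \<Rightarrow> ('i \<Rightarrow> 'p) rel" where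
  "entails_rel \<Sigma> I =
     {(\<phi>, \<psi>). \<phi> \<in> I \<rightarrow>\<^sub>E Pset \<Sigma> \<and> \<psi> \<in> I \<rightarrow>\<^sub>E Pset \<Sigma> \<and> entails \<Sigma> I \<phi> \<psi>}"

definition prop_entails :: "('p, 'r) pr_data \<Rightarrow> 'p \<Rightarrow> 'p \<Rightarrow> bool" where
  "prop_entails \<Sigma> a b \<longleftrightarrow> rho \<Sigma> a b \<noteq> {}"

text \<open>
  HOL cannot quantify over types inside a formula, so ``for every set \<open>I\<close>'' is rendered as
  ``for every set \<open>I\<close> of elements of \<open>'i\<close>'' with \<open>'i\<close> an arbitrary type.  By
  \<open>preorderal_transfer\<close> and \<open>posetal_transfer\<close> below, a single sufficiently large \<open>'i\<close>
  already covers the index sets of all types.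
\<close>

definition preorderal :: "'i itself \<Rightarrow> ('p, 'r) pr_data \<Rightarrow> bool" where
  "preorderal T \<Sigma> \<longleftrightarrow> (\<forall>I :: 'i set. preorder_on (I \<rightarrow>\<^sub>E Pset \<Sigma>) (entails_rel \<Sigma> I))"

definition posetal :: "'i itself \<Rightarrow> ('p, 'r) pr_data \<Rightarrow> bool" where
  "posetal T \<Sigma> \<longleftrightarrow> (\<forall>I :: 'i set. partial_order_on (I \<rightarrow>\<^sub>E Pset \<Sigma>) (entails_rel \<Sigma> I))"

lemma entails_rel_iff:
  "(\<phi>, \<psi>) \<in> entails_rel \<Sigma> I \<longleftrightarrow>
     \<phi> \<in> I \<rightarrow>\<^sub>E Pset \<Sigma> \<and> \<psi> \<in> I \<rightarrow>\<^sub>E Pset \<Sigma> \<and> entails \<Sigma> I \<phi> \<psi>"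
  by (simp add: entails_rel_def)

lemma entails_rel_image:
  assumes "\<And>j. j \<in> J \<Longrightarrow> g (f j) = \<phi> j" "\<And>j. j \<in> J \<Longrightarrow> h (f j) = \<psi> j"
    and "\<phi> \<in> J \<rightarrow>\<^sub>E Pset \<Sigma>" "\<psi> \<in> J \<rightarrow>\<^sub>E Pset \<Sigma>"
  shows "(restrict g (f ` J), restrict h (f ` J)) \<in> entails_rel \<Sigma> (f ` J) \<longleftrightarrow>
    (\<phi>, \<psi>) \<in> entails_rel \<Sigma> J"
proof -
  have "restrict g (f ` J) \<in> f ` J \<rightarrow>\<^sub>E Pset \<Sigma>" "restrict h (f ` J) \<in> f ` J \<rightarrow>\<^sub>E Pset \<Sigma>"
    using assms by (auto simp: PiE_iff)
  then show ?thesis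
    using assms by (simp add: entails_rel_iff entails_def)
qed

lemma preorderal_transfer:
  fixes \<Sigma> :: "('p, 'r) pr_data"
  assumes "preorderal TYPE('p \<times> 'p \<times> 'p) \<Sigma>"
  shows "preorderal TYPE('j) \<Sigma>"
  unfolding preorderal_def
proof
  fix J :: "'j set"
  let ?F = "J \<rightarrow>\<^sub>E Pset \<Sigma>" and ?p = "\<lambda>x :: 'p \<times> 'p \<times> 'p. fst (snd x)"
  let ?q = "\<lambda>x :: 'p \<times> 'p \<times> 'p. snd (snd x)"
  have pre: "refl_on (I \<rightarrow>\<^sub>E Pset \<Sigma>) (entails_rel \<Sigma> I)" "trans (entails_rel \<Sigma> I)"
    for I :: "('p \<times> 'p \<times> 'p) set"
    using assms by (auto simp: preorderal_def preorder_on_def)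
  have sub: "entails_rel \<Sigma> J \<subseteq> ?F \<times> ?F"
    by (auto simp: entails_rel_iff)
  have refl: "(\<phi>, \<phi>) \<in> entails_rel \<Sigma> J" if \<phi>: "\<phi> \<in> ?F" for \<phi>
  proof -
    define f where "f j = (\<phi> j, \<phi> j, \<phi> j)" for j
    have "restrict fst (f ` J) \<in> f ` J \<rightarrow>\<^sub>E Pset \<Sigma>"
      using \<phi> by (auto simp: f_def PiE_iff)
    then have "(restrict fst (f ` J), restrict fst (f ` J)) \<in> entails_rel \<Sigma> (f ` J)"
      using pre(1) by (meson refl_onD)
    then show ?thesis
      using entails_rel_image[of J fst f \<phi> fst \<phi> \<Sigma>] \<phi> by (simp add: f_def)
  qed
  have tr: "(\<phi>, \<chi>) \<in> entails_rel \<Sigma> J"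
    if 1: "(\<phi>, \<psi>) \<in> entails_rel \<Sigma> J" and 2: "(\<psi>, \<chi>) \<in> entails_rel \<Sigma> J" for \<phi> \<psi> \<chi>
  proof -
    define f where "f j = (\<phi> j, \<psi> j, \<chi> j)" for j
    have F: "\<phi> \<in> ?F" "\<psi> \<in> ?F" "\<chi> \<in> ?F"
      using 1 2 sub by auto
    have "(restrict fst (f ` J), restrict ?p (f ` J)) \<in> entails_rel \<Sigma> (f ` J)"
      using entails_rel_image[of J fst f \<phi> ?p \<psi> \<Sigma>] F 1 by (simp add: f_def)
    moreover have "(restrict ?p (f ` J), restrict ?q (f ` J)) \<in> entails_rel \<Sigma> (f ` J)"
      using entails_rel_image[of J ?p f \<psi> ?q \<chi> \<Sigma>] F 2 by (simp add: f_def)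
    ultimately have "(restrict fst (f ` J), restrict ?q (f ` J)) \<in> entails_rel \<Sigma> (f ` J)"
      using pre(2) by (meson transD)
    then show ?thesis
      using entails_rel_image[of J fst f \<phi> ?q \<chi> \<Sigma>] F by (simp add: f_def)
  qed
  show "preorder_on ?F (entails_rel \<Sigma> J)"
    unfolding preorder_on_def using sub refl tr by (auto intro!: refl_onI transI)
qed

lemma posetal_transfer:
  fixes \<Sigma> :: "('p, 'r) pr_data"
  assumes "posetal TYPE('p \<times> 'p \<times> 'p) \<Sigma>"
  shows "posetal TYPE('j) \<Sigma>"
  unfolding posetal_def
proof
  fix J :: "'j set"
  let ?p = "\<lambda>x :: 'p \<times> 'p \<times> 'p. fst (snd x)"
  have "preorderal TYPE('p \<times> 'p \<times> 'p) \<Sigma>"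
    using assms by (simp add: posetal_def preorderal_def partial_order_on_def)
  then have "preorderal TYPE('j) \<Sigma>"
    by (rule preorderal_transfer)
  then have "preorder_on (J \<rightarrow>\<^sub>E Pset \<Sigma>) (entails_rel \<Sigma> J)"
    by (simp add: preorderal_def)
  moreover have "\<phi> = \<psi>"
    if 1: "(\<phi>, \<psi>) \<in> entails_rel \<Sigma> J" and 2: "(\<psi>, \<phi>) \<in> entails_rel \<Sigma> J" for \<phi> \<psi>
  proof -
    define f where "f j = (\<phi> j, \<psi> j, \<psi> j)" for j
    have F: "\<phi> \<in> J \<rightarrow>\<^sub>E Pset \<Sigma>" "\<psi> \<in> J \<rightarrow>\<^sub>E Pset \<Sigma>"
      using 1 by (auto simp: entails_rel_iff)
    have "(restrict fst (f ` J), restrict ?p (f ` J)) \<in> entails_rel \<Sigma> (f ` J)"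
      using entails_rel_image[of J fst f \<phi> ?p \<psi> \<Sigma>] F 1 by (simp add: f_def)
    moreover have "(restrict ?p (f ` J), restrict fst (f ` J)) \<in> entails_rel \<Sigma> (f ` J)"
      using entails_rel_image[of J ?p f \<psi> fst \<phi> \<Sigma>] F 2 by (simp add: f_def)
    moreover have "antisym (entails_rel \<Sigma> (f ` J))"
      using assms by (simp add: posetal_def partial_order_on_def)
    ultimately have eq: "restrict fst (f ` J) = restrict ?p (f ` J)"
      by (meson antisymD)
    have "\<phi> j = \<psi> j" if "j \<in> J" for j
      using fun_cong[OF eq, of "f j"] that by (simp add: f_def)
    then show ?thesis
      using F by (auto intro: PiE_ext)
  qed
  ultimately show "partial_order_on (J \<rightarrow>\<^sub>E Pset \<Sigma>) (entails_rel \<Sigma> J)"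
    unfolding partial_order_on_def by (auto intro: antisymI)
qed

end

theory Submission
  imports Defs
begin

text \<open>Being posetal is being preorderal together with antisymmetry of every
  \<open>entails_rel \<Sigma> I\<close>, so only antisymmetry has to be compared. A witness common
  to all indices is a witness at each index, so antisymmetry of \<open>prop_entails \<Sigma>\<close>
  lifts pointwise to every \<open>I\<close> (\<open>antisym_entails_rel\<close>). Conversely, over a
  one-element index set the relation is a copy of \<open>prop_entails \<Sigma>\<close>
  (\<open>singleton_entails_rel_iff\<close>), so antisymmetry there descends to
  \<open>Pset \<Sigma>\<close>.\<close>

lemma singleton_entails_rel_iff:
  assumes "pr_structure \<Sigma>" "a \<in> Pset \<Sigma>" "b \<in> Pset \<Sigma>"
  shows "((\<lambda>j\<in>{i}. a), (\<lambda>j\<in>{i}. b)) \<in> entails_rel \<Sigma> {i} \<longleftrightarrow> prop_entails \<Sigma> a b"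
proof -
  \<comment> \<open>\<open>prop_entails\<close> accepts any element of
    \<open>rho \<Sigma> a b\<close>, while \<open>entails\<close> asks for a witness in
    \<open>Rset \<Sigma>\<close>; closure reconciles the two.\<close>
  have "rho \<Sigma> a b \<subseteq> Rset \<Sigma>"
    using assms by (rule pr_structure.rho_closed)
  then show ?thesis
    using assms(2,3) by (auto simp: entails_rel_iff entails_def prop_entails_def)
qed

lemma entails_rel_imp_prop_entails:
  "(\<phi>, \<psi>) \<in> entails_rel \<Sigma> I \<Longrightarrow> i \<in> I \<Longrightarrow> prop_entails \<Sigma> (\<phi> i) (\<psi> i)"
  by (auto simp: entails_rel_iff entails_def prop_entails_def)

text \<open>The two directions may have different witnesses, since only non-emptiness at each index
  is used. The case \<open>I = {}\<close> is included: there extensionality leaves a single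
  function.\<close>

lemma antisym_entails_rel:
  assumes "antisymp_on (Pset \<Sigma>) (prop_entails \<Sigma>)"
  shows "antisym (entails_rel \<Sigma> I)"
proof (rule antisymI)
  fix \<phi> \<psi>
  assume 1: "(\<phi>, \<psi>) \<in> entails_rel \<Sigma> I" and 2: "(\<psi>, \<phi>) \<in> entails_rel \<Sigma> I"
  have F: "\<phi> \<in> I \<rightarrow>\<^sub>E Pset \<Sigma>" "\<psi> \<in> I \<rightarrow>\<^sub>E Pset \<Sigma>"
    using 1 by (auto simp: entails_rel_iff)
  show "\<phi> = \<psi>"
  proof (rule PiE_ext[OF F])
    fix i assume i: "i \<in> I"
    show "\<phi> i = \<psi> i"
      by (rule antisymp_onD[OF assms PiE_mem[OF F(1) i] PiE_mem[OF F(2) i]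
            entails_rel_imp_prop_entails[OF 1 i] entails_rel_imp_prop_entails[OF 2 i]])
  qed
qed

text \<open>Elements are encoded as constant functions on \<open>{i}\<close>, and evaluation at
  \<open>i\<close> recovers them.\<close>

lemma antisymp_on_prop_entails:
  assumes "pr_structure \<Sigma>" "antisym (entails_rel \<Sigma> {i})"
  shows "antisymp_on (Pset \<Sigma>) (prop_entails \<Sigma>)"
proof (rule antisymp_onI)
  fix a b
  assume "a \<in> Pset \<Sigma>" "b \<in> Pset \<Sigma>" "prop_entails \<Sigma> a b" "prop_entails \<Sigma> b a"
  then have "(\<lambda>j\<in>{i}. a) = (\<lambda>j\<in>{i}. b)"
    by (intro antisymD[OF assms(2)]) (simp_all only: singleton_entails_rel_iff[OF assms(1)])
  then have "(\<lambda>j\<in>{i}. a) i = (\<lambda>j\<in>{i}. b) i"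
    by (rule fun_cong)
  then show "a = b"
    by simp
qed

theorem theorem2p21:
  fixes \<Sigma> :: "('p, 'r) pr_data"
  assumes "pr_structure \<Sigma>"
  shows "posetal TYPE('i) \<Sigma> \<longleftrightarrow>
    preorderal TYPE('i) \<Sigma> \<and> antisymp_on (Pset \<Sigma>) (prop_entails \<Sigma>)"
proof
  assume pos: "posetal TYPE('i) \<Sigma>"
  \<comment> \<open>Every HOL type is inhabited, so \<open>undefined\<close> supplies a one-element
    index set whatever \<open>'i\<close> is.\<close>
  then have "antisym (entails_rel \<Sigma> {undefined :: 'i})"
    unfolding posetal_def partial_order_on_def by blast
  then have "antisymp_on (Pset \<Sigma>) (prop_entails \<Sigma>)"
    by (rule antisymp_on_prop_entails[OF assms])
  moreover have "preorderal TYPE('i) \<Sigma>"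
    using pos unfolding posetal_def preorderal_def partial_order_on_def by blast
  ultimately show "preorderal TYPE('i) \<Sigma> \<and> antisymp_on (Pset \<Sigma>) (prop_entails \<Sigma>)"
    by blast
next
  assume "preorderal TYPE('i) \<Sigma> \<and> antisymp_on (Pset \<Sigma>) (prop_entails \<Sigma>)"
  then show "posetal TYPE('i) \<Sigma>"
    unfolding posetal_def preorderal_def partial_order_on_def
    by (simp add: antisym_entails_rel)
qed

end
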